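(* Consider the model and the truncated Markov chain described in the context. Assume that the economy returns to its intended steady state ($\pi=0$ and $c=0$) in the long run, and that the parameters satisfy $$\psi>m_{x\pi}+\frac{(1-m_{xx})(\beta m_{\pi\pi}-1)}{\kappa(1+\eta\bar c)\sigma}.$$ Then there exist a function $\bar d_N:(0,1)\to\mathbb{R}$ and a threshold $\bar p\in(0,1)$ such that, for a given $p$: 1. if $d\in[0,\bar d_N(p))$, then the economy remains in the normal-time regime for all time periods, and $\lim_{\ell\to\infty}\tilde\pi_t(\ell)=\pi^N_t<\infty$ as well as $\lim_{\ell\to\infty}\tilde c_t(\ell)=c^N_t<\infty$; 2. if $d\in[\bar d(0),d^{max}]$, then the economy remains in the effective-lower-bound (ELB) regime for all time periods; 3. if $d\in[\bar d(0),d^{max}]$ and $p<\bar p$, then $\lim_{\ell\to\infty}\tilde c_t(\ell)=c^L_t$ and $\lim_{\ell\to\infty}\tilde\pi_t(\ell)=\pi^L_t$; if $d\in[\bar d(0),d^{max}]$ and $p\geq\bar p$, then both variables $\tilde c_t(\ell)$ and $\tilde\pi_t(\ell)$ diverge to $-\infty$ as $\ell\to\infty$.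
   Context: Parameters: $\sigma,\kappa,\eta,\psi,\mu>0$, $\beta\in(0,1)$, $\bar c\in(0,1)$, $m_{xx},m_{x\pi},m_{\pi\pi}\in(0,1]$; $d^{max}$ is the maximum value of the shock. Write $\bar\pi:=-\mu/\psi$. Model (no government spending): for each date $t$, $$c_t=m_{xx}\mathbb{E}_tc_{t+1}-\sigma(i_t-m_{x\pi}\mathbb{E}_t\pi_{t+1}+d_t),\quad \pi_t=m_{\pi\pi}\beta\,\mathbb{E}_t\pi_{t+1}+\kappa(1+\eta\bar c)c_t,\quad i_t=\max\{\psi\pi_t,-\mu\},$$ where $c_t$ is private consumption, $\pi_t$ inflation, $i_t$ the nominal interest rate and $d_t$ a demand shock. The ELB binds when $\pi_t\leq\bar\pi$. Truncated Markov chain with maximum duration $\ell$: at date $t$ the shock starts in the low state, $d_t=d$. In periods $t,\dots,t+\ell-1$ it follows a two-state Markov chain: from the low state (value $d$) it stays there with probability $p$ and moves to the absorbing state (value $0$) with probability $1-p$; the absorbing state is never left. If it is not back in the absorbing state after these $\ell$ periods, it jumps there deterministically. Once the shock is in the absorbing state, $c=\pi=0$. For each finite $\ell\geq1$ there is a unique equilibrium sequence; $\tilde c_{t+n}(\ell),\tilde\pi_{t+n}(\ell)$, $n=0,\dots,\ell-1$, denote equilibrium consumption and inflation at $t+n$ conditional on the shock still being in its low state. Regimes: the economy remains in the normal-time regime for all time periods if $\tilde\pi_{t+n}(\ell)>\bar\pi$ for all $n=0,\dots,\ell-1$; it remains in the ELB regime for all time periods if $\tilde\pi_{t+n}(\ell)\leq\bar\pi$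 for all $n=0,\dots,\ell-1$. The number $\bar d(0)$ is the value at $p=0$ of $$\bar d(p):=\frac{\mu\left[(1-pm_{xx})(1-p\beta m_{\pi\pi})+\sigma\kappa(1+\eta\bar c)(\psi-pm_{x\pi})\right]}{\sigma\psi\kappa(1+\eta\bar c)}.$$ Constant solutions: $(c^N_t,\pi^N_t)$ and $(c^L_t,\pi^L_t)$ are the normal-time and liquidity-trap solutions under the untruncated ($\ell=\infty$) two-state absorbing Markov chain, i.e. the constant low-state allocations $(c,\pi)$ obtained by setting $\mathbb{E}_tc_{t+1}=pc$, $\mathbb{E}_t\pi_{t+1}=p\pi$, $d_t=d$ in the first two model equations, with $i=\psi\pi$ for $N$ and $i=-\mu$ for $L$.
   Formalization: The threshold p̄ is only claimed in (0,1], and in (0,1) when (1−m_xx)(1−βm_ππ) < σκ(1+ηc̄)m_xπ; otherwise the ELB paths converge for every p in (0,1), so no p̄<1 can satisfy the divergence claim in item 3. *)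

theory Defs
  imports "HOL-Probability.Probability_Mass_Function"
begin

record nk_model =
  sigma :: real
  kappa :: real
  eta :: real
  psi :: real
  mu :: real
  beta :: real
  cbar :: real
  mxx :: real
  mxpi :: real
  mpipi :: real

definition admissible :: "nk_model \<Rightarrow> bool" where
  "admissible M \<longleftrightarrow>
     sigma M > 0 \<and> kappa M > 0 \<and> eta M > 0 \<and> psi M > 0 \<and> mu M > 0 \<and>
     beta M \<in> {0<..<1} \<and> cbar M \<in> {0<..<1} \<and>
     mxx M \<in> {0<..1} \<and> mxpi M \<in> {0<..1} \<and> mpipi M \<in> {0<..1}"

definition pibar :: "nk_model \<Rightarrow> real" where
  "pibar M = - mu M / psi M"

definition dbar :: "nk_model \<Rightarrow> real \<Rightarrow> real" where
  "dbar M p =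
     mu M * ((1 - p * mxx M) * (1 - p * beta M * mpipi M)
             + sigma M * kappa M * (1 + eta M * cbar M) * (psi M - p * mxpi M))
     / (sigma M * psi M * kappa M * (1 + eta M * cbar M))"

datatype shock_state = Low | Absorbed

fun shock_value :: "real \<Rightarrow> shock_state \<Rightarrow> real" where
  "shock_value d Low = d"
| "shock_value d Absorbed = 0"

text \<open>
  Dates are counted from the initial date \<open>t\<close>. The kernel gives the law of the shock state
  at \<open>t + n + 1\<close> given its state at \<open>t + n\<close>. With maximum duration \<open>l\<close> the low state
  is possible exactly at \<open>t, \<dots>, t + l - 1\<close>.
\<close>

definition shock_kernel :: "real \<Rightarrow> nat \<Rightarrow> nat \<Rightarrow> shock_state \<Rightarrow> shock_state pmf" where
  "shock_kernel p l n s =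
     (if s = Low \<and> Suc n < l
      then map_pmf (\<lambda>b. if b then Low else Absorbed) (bernoulli_pmf p)
      else return_pmf Absorbed)"

text \<open>
  The expectation, conditional on state \<open>s\<close> at \<open>t + n\<close>, of the value at \<open>t + n + 1\<close> of the
  variable \<open>X\<close>, which is a function of the date and of the shock state.
\<close>

definition expect_next ::
    "real \<Rightarrow> nat \<Rightarrow> nat \<Rightarrow> shock_state \<Rightarrow> (nat \<Rightarrow> shock_state \<Rightarrow> real) \<Rightarrow> real" where
  "expect_next p l n s X = measure_pmf.expectation (shock_kernel p l n s) (X (Suc n))"

definition policy_rate :: "nk_model \<Rightarrow> real \<Rightarrow> real" where
  "policy_rate M x = max (psi M * x) (- mu M)"

text \<open>
  The model equations are imposed wherever the state is possible. The last conjunct is the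
  return to the intended steady state once the shock has been absorbed. Values at
  \<open>(n, Low)\<close> with \<open>n \<ge> l\<close> are irrelevant.
\<close>

definition equilibrium ::
    "nk_model \<Rightarrow> real \<Rightarrow> real \<Rightarrow> nat \<Rightarrow> (nat \<Rightarrow> shock_state \<Rightarrow> real)
       \<Rightarrow> (nat \<Rightarrow> shock_state \<Rightarrow> real) \<Rightarrow> bool" where
  "equilibrium M p d l c \<pi> \<longleftrightarrow>
     (\<forall>n s. s = Absorbed \<or> n < l \<longrightarrow>
        c n s = mxx M * expect_next p l n s c
                - sigma M * (policy_rate M (\<pi> n s) - mxpi M * expect_next p l n s \<pi>
                             + shock_value d s) \<and>
        \<pi> n s = mpipi M * beta M * expect_next p l n s \<pi>
                + kappa M * (1 + eta M * cbar M) * c n s) \<and>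
     (\<forall>n. c n Absorbed = 0 \<and> \<pi> n Absorbed = 0)"

text \<open>
  Equilibrium consumption and inflation at \<open>t + n\<close> conditional on the low state, for \<open>n < l\<close>.
  The lemmas \<open>c_low_eq\<close> and \<open>pi_low_eq\<close> below show that these descriptions are proper.
\<close>

definition c_low :: "nk_model \<Rightarrow> real \<Rightarrow> real \<Rightarrow> nat \<Rightarrow> nat \<Rightarrow> real" where
  "c_low M p d l n = (THE x. \<exists>c \<pi>. equilibrium M p d l c \<pi> \<and> x = c n Low)"

definition pi_low :: "nk_model \<Rightarrow> real \<Rightarrow> real \<Rightarrow> nat \<Rightarrow> nat \<Rightarrow> real" where
  "pi_low M p d l n = (THE x. \<exists>c \<pi>. equilibrium M p d l c \<pi> \<and> x = \<pi> n Low)"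

definition remains_normal :: "nk_model \<Rightarrow> real \<Rightarrow> real \<Rightarrow> nat \<Rightarrow> bool" where
  "remains_normal M p d l \<longleftrightarrow> (\<forall>n<l. pi_low M p d l n > pibar M)"

definition remains_elb :: "nk_model \<Rightarrow> real \<Rightarrow> real \<Rightarrow> nat \<Rightarrow> bool" where
  "remains_elb M p d l \<longleftrightarrow> (\<forall>n<l. pi_low M p d l n \<le> pibar M)"

text \<open>
  Constant low-state allocation of the untruncated chain, for an interest rate given as a
  function of inflation.
\<close>

definition is_constant_allocation ::
    "nk_model \<Rightarrow> real \<Rightarrow> real \<Rightarrow> (real \<Rightarrow> real) \<Rightarrow> real \<Rightarrow> real \<Rightarrow> bool" where
  "is_constant_allocation M p d i c \<pi> \<longleftrightarrow>
     c = mxx M * (p * c) - sigma M * (i \<pi> - mxpi M * (p * \<pi>) + d) \<and>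
     \<pi> = mpipi M * beta M * (p * \<pi>) + kappa M * (1 + eta M * cbar M) * c"

definition normal_allocation :: "nk_model \<Rightarrow> real \<Rightarrow> real \<Rightarrow> real \<times> real" where
  "normal_allocation M p d =
     (THE (c, \<pi>). is_constant_allocation M p d (\<lambda>x. psi M * x) c \<pi>)"

definition trap_allocation :: "nk_model \<Rightarrow> real \<Rightarrow> real \<Rightarrow> real \<times> real" where
  "trap_allocation M p d =
     (THE (c, \<pi>). is_constant_allocation M p d (\<lambda>_. - mu M) c \<pi>)"

abbreviation c_normal :: "nk_model \<Rightarrow> real \<Rightarrow> real \<Rightarrow> real" where
  "c_normal M p d \<equiv> fst (normal_allocation M p d)"

abbreviation pi_normal :: "nk_model \<Rightarrow> real \<Rightarrow> real \<Rightarrow> real" where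
  "pi_normal M p d \<equiv> snd (normal_allocation M p d)"

abbreviation c_trap :: "nk_model \<Rightarrow> real \<Rightarrow> real \<Rightarrow> real" where
  "c_trap M p d \<equiv> fst (trap_allocation M p d)"

abbreviation pi_trap :: "nk_model \<Rightarrow> real \<Rightarrow> real \<Rightarrow> real" where
  "pi_trap M p d \<equiv> snd (trap_allocation M p d)"


lemma slope_pos:
  assumes "admissible M"
  shows "kappa M * (1 + eta M * cbar M) > 0"
  using assms unfolding admissible_def by (auto intro!: mult_pos_pos add_pos_pos)

lemma expect_next_simps:
  assumes "p \<in> {0..1}"
  shows "expect_next p l n Low X =
           (if Suc n < l then p * X (Suc n) Low + (1 - p) * X (Suc n) Absorbed
            else X (Suc n) Absorbed)"
    and "expect_next p l n Absorbed X = X (Suc n) Absorbed"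
  using assms by (auto simp: expect_next_def shock_kernel_def)

lemma one_period_ex:
  fixes s K a m :: real
  assumes "s > 0" "K > 0" "a > 0"
  shows "\<exists>c x. c = X - s * max (a * x) (- m) \<and> x = Y + K * c"
proof (cases "a * (Y + K * X + K * s * m) \<le> - m")
  case True
  then show ?thesis
    by (intro exI[of _ "X + s * m"] exI[of _ "Y + K * (X + s * m)"])
       (simp add: max_def algebra_simps)
next
  case False
  define D where "D = 1 + K * s * a"
  have D: "D > 0" using assms by (simp add: D_def add_pos_pos)
  define x where "x = (Y + K * X) / D"
  have xD: "x * D = Y + K * X" using D by (simp add: x_def)
  have "a * (Y + K * X) > - m * D"
    using False by (simp add: D_def algebra_simps)
  then have "a * x > - m"
    using D by (simp add: x_def pos_less_divide_eq)
  moreover have "x = Y + K * (X - s * (a * x))"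
    using xD by (simp add: D_def algebra_simps)
  ultimately show ?thesis
    by (intro exI[of _ "X - s * (a * x)"] exI[of _ x]) (simp add: max_def)
qed

lemma one_period_unique:
  fixes s K a m :: real
  assumes "s > 0" "K > 0" "a > 0"
    and "c = X - s * max (a * x) (- m)" "x = Y + K * c"
    and "c' = X - s * max (a * x') (- m)" "x' = Y + K * c'"
  shows "c = c' \<and> x = x'"
proof -
  have mono: "max (a * u) (- m) \<le> max (a * v) (- m)" if "u \<le> v" for u v
    using that assms(3) by (intro max.mono mult_left_mono) auto
  have "c \<le> c'" if "x \<ge> x'"
    using mono[OF that] assms(1,4,6) by simp
  moreover have "c' \<le> c" if "x' \<ge> x"
    using mono[OF that] assms(1,4,6) by simp
  moreover have "x \<le> x' \<longleftrightarrow> c \<le> c'" "x' \<le> x \<longleftrightarrow> c' \<le> c"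
    using assms(2,5,7) by simp_all
  ultimately have "c = c'" by linarith
  then show ?thesis using assms(5,7) by simp
qed

lemma equilibrium_exists:
  assumes M: "admissible M" and p: "p \<in> {0..1}"
  shows "\<exists>c \<pi>. equilibrium M p d l c \<pi>"
proof -
  define K where "K = kappa M * (1 + eta M * cbar M)"
  define P where "P = (\<lambda>(u, v) (c, x).
    c = mxx M * (p * u) - sigma M * (policy_rate M x - mxpi M * (p * v) + d) \<and>
    x = mpipi M * beta M * (p * v) + K * c)"
  have pos: "sigma M > 0" "K > 0" "psi M > 0"
    using M slope_pos[OF M] by (auto simp: admissible_def K_def)
  have P_iff: "P z y \<longleftrightarrow>
      fst y = mxx M * (p * fst z)
        - sigma M * (policy_rate M (snd y) - mxpi M * (p * snd z) + d) \<and>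
      snd y = mpipi M * beta M * (p * snd z) + K * fst y" for z y
    by (cases z; cases y) (simp add: P_def)
  have ex: "\<exists>y. P z y" for z
  proof -
    obtain u v where z: "z = (u, v)" by force
    obtain c x where "c = (mxx M * (p * u) + sigma M * (mxpi M * (p * v) - d))
        - sigma M * max (psi M * x) (- mu M)" "x = mpipi M * beta M * (p * v) + K * c"
      using one_period_ex[OF pos] by blast
    then have "P z (c, x)" by (simp add: P_def z policy_rate_def algebra_simps)
    then show ?thesis ..
  qed
  define g where "g = rec_nat (0, 0) (\<lambda>_ z. SOME y. P z y)"
  have g0: "g 0 = (0, 0)" and gS: "P (g k) (g (Suc k))" for k
    using someI_ex[OF ex] by (simp_all add: g_def)
  define c where "c = (\<lambda>n s. if s = Low then fst (g (l - n)) else 0)"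
  define \<pi> where "\<pi> = (\<lambda>n s. if s = Low then snd (g (l - n)) else 0)"
  have e: "expect_next p l n Low c = p * fst (g (l - Suc n))"
          "expect_next p l n Low \<pi> = p * snd (g (l - Suc n))" for n
    using p by (auto simp: expect_next_simps c_def \<pi>_def g0)
  have a: "expect_next p l n Absorbed c = 0" "expect_next p l n Absorbed \<pi> = 0" for n
    using p by (auto simp: expect_next_simps c_def \<pi>_def)
  have "equilibrium M p d l c \<pi>"
    unfolding equilibrium_def
  proof (intro conjI allI impI)
    fix n s assume H: "s = Absorbed \<or> n < l"
    show "c n s = mxx M * expect_next p l n s c - sigma M *
        (policy_rate M (\<pi> n s) - mxpi M * expect_next p l n s \<pi> + shock_value d s)"
    proof (cases s)
      case Absorbed
      then show ?thesis
        using M by (simp add: a) (simp add: c_def \<pi>_def policy_rate_def admissible_def)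
    next
      case Low
      with H have "P (g (l - Suc n)) (g (l - n))"
        using gS[of "l - Suc n"] by (simp add: Suc_diff_Suc)
      then show ?thesis
        unfolding P_iff Low e
        unfolding c_def \<pi>_def shock_value.simps simp_thms if_True by (rule conjunct1)
    qed
    show "\<pi> n s = mpipi M * beta M * expect_next p l n s \<pi>
        + kappa M * (1 + eta M * cbar M) * c n s"
    proof (cases s)
      case Absorbed
      then show ?thesis by (simp add: a) (simp add: c_def \<pi>_def)
    next
      case Low
      with H have "P (g (l - Suc n)) (g (l - n))"
        using gS[of "l - Suc n"] by (simp add: Suc_diff_Suc)
      then show ?thesis
        unfolding P_iff Low e K_def
        unfolding c_def \<pi>_def shock_value.simps simp_thms if_True by (rule conjunct2)
    qed
  qed (auto simp: c_def \<pi>_def)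
  then show ?thesis by blast
qed

lemma equilibrium_unique:
  assumes M: "admissible M" and p: "p \<in> {0..1}"
    and E: "equilibrium M p d l c \<pi>" "equilibrium M p d l c' \<pi>'"
    and n: "n < l"
  shows "c n Low = c' n Low \<and> \<pi> n Low = \<pi>' n Low"
proof -
  define K where "K = kappa M * (1 + eta M * cbar M)"
  have pos: "sigma M > 0" "K > 0" "psi M > 0"
    using M slope_pos[OF M] by (auto simp: admissible_def K_def)
  show ?thesis
    using n
  proof (induction "l - n" arbitrary: n rule: less_induct)
    case less
    have zero: "c (Suc n) Absorbed = 0" "c' (Suc n) Absorbed = 0"
               "\<pi> (Suc n) Absorbed = 0" "\<pi>' (Suc n) Absorbed = 0"
      using E by (simp_all only: equilibrium_def)
    have "c (Suc n) Low = c' (Suc n) Low \<and> \<pi> (Suc n) Low = \<pi>' (Suc n) Low" if "Suc n < l"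
      using less.hyps[of "Suc n"] less.prems that by simp
    then have e: "expect_next p l n Low c = expect_next p l n Low c'"
                 "expect_next p l n Low \<pi> = expect_next p l n Low \<pi>'"
      using p by (simp_all add: expect_next_simps zero)
    let ?X = "mxx M * expect_next p l n Low c'
                + sigma M * (mxpi M * expect_next p l n Low \<pi>' - d)"
    let ?Y = "mpipi M * beta M * expect_next p l n Low \<pi>'"
    have eqs: "x n Low = mxx M * expect_next p l n Low x - sigma M *
          (policy_rate M (y n Low) - mxpi M * expect_next p l n Low y + d)"
        "y n Low = mpipi M * beta M * expect_next p l n Low y + K * x n Low"
      if "equilibrium M p d l x y" for x y
    proof -
      have "\<forall>n s. s = Absorbed \<or> n < l \<longrightarrow>
          x n s = mxx M * expect_next p l n s x - sigma M *
            (policy_rate M (y n s) - mxpi M * expect_next p l n s y + shock_value d s) \<and>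
          y n s = mpipi M * beta M * expect_next p l n s y
            + kappa M * (1 + eta M * cbar M) * x n s"
        using that unfolding equilibrium_def by (rule conjunct1)
      from this[rule_format, of Low n, OF disjI2, OF less.prems]
      show "x n Low = mxx M * expect_next p l n Low x - sigma M *
            (policy_rate M (y n Low) - mxpi M * expect_next p l n Low y + d)"
        and "y n Low = mpipi M * beta M * expect_next p l n Low y + K * x n Low"
        unfolding K_def shock_value.simps by (rule conjunct1, rule conjunct2)
    qed
    show ?case
    proof (rule one_period_unique[OF pos, where X = ?X and Y = ?Y and m = "mu M"])
      show "c n Low = ?X - sigma M * max (psi M * \<pi> n Low) (- mu M)"
        by (subst eqs(1)[OF E(1)]) (simp add: e policy_rate_def algebra_simps)
      show "c' n Low = ?X - sigma M * max (psi M * \<pi>' n Low) (- mu M)"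
        by (subst eqs(1)[OF E(2)]) (simp add: policy_rate_def algebra_simps)
      show "\<pi> n Low = ?Y + K * c n Low"
        by (subst eqs(2)[OF E(1)]) (simp add: e)
      show "\<pi>' n Low = ?Y + K * c' n Low"
        by (rule eqs(2)[OF E(2)])
    qed
  qed
qed

lemma c_low_eq:
  assumes "admissible M" "p \<in> {0..1}" "equilibrium M p d l c \<pi>" "n < l"
  shows "c_low M p d l n = c n Low"
  unfolding c_low_def
proof (rule the_equality)
  show "\<exists>c' \<pi>'. equilibrium M p d l c' \<pi>' \<and> c n Low = c' n Low"
    using assms(3) by blast
next
  fix x assume "\<exists>c' \<pi>'. equilibrium M p d l c' \<pi>' \<and> x = c' n Low"
  then obtain c' \<pi>' where "equilibrium M p d l c' \<pi>'" "x = c' n Low" by auto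
  then show "x = c n Low"
    using equilibrium_unique[OF assms(1,2) _ assms(3,4)] by auto
qed

lemma pi_low_eq:
  assumes "admissible M" "p \<in> {0..1}" "equilibrium M p d l c \<pi>" "n < l"
  shows "pi_low M p d l n = \<pi> n Low"
  unfolding pi_low_def
proof (rule the_equality)
  show "\<exists>c' \<pi>'. equilibrium M p d l c' \<pi>' \<and> \<pi> n Low = \<pi>' n Low"
    using assms(3) by blast
next
  fix x assume "\<exists>c' \<pi>'. equilibrium M p d l c' \<pi>' \<and> x = \<pi>' n Low"
  then obtain c' \<pi>' where "equilibrium M p d l c' \<pi>'" "x = \<pi>' n Low" by auto
  then show "x = \<pi> n Low"
    using equilibrium_unique[OF assms(1,2) _ assms(3,4)] by auto
qed

end

theory Submission
  imports Defs
begin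

text \<open>
  Low-state values depend only on the number of periods the low state may still last, so
  equilibria of all lengths are read off one sequence started at the steady state.

  In the normal regime inflation obeys a second-order linear recursion whose coefficients
  satisfy the Jury conditions, so it converges; the path is proportional to \<open>d\<close>, hence stays
  above the ELB threshold for small \<open>d\<close>.

  In the ELB regime the recursion is monotone and its first step \<open>\<sigma> (\<mu> - d)\<close> is negative, so the
  path decreases; \<open>d \<ge> dbar 0\<close> says that the first step is already at the ELB. The path is bounded
  exactly if the recursion has a nonpositive fixed point, that is, if
  \<open>(1 - p m\<^sub>x\<^sub>x) (1 - p \<beta> m\<^sub>\<pi>\<^sub>\<pi>) > \<sigma> \<kappa> (1 + \<eta> cbar) p m\<^sub>x\<^sub>\<pi>\<close>. The threshold is the root of this
  decreasing difference, or 1 if there is none below 1.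
\<close>

section \<open>Two convergence facts for real sequences\<close>

text \<open>The argument avoids the characteristic roots, which may be complex or repeated. A
  nonnegative decreasing quadratic form has drops tending to 0, so \<open>y (k + 2) - y k\<close>
  tends to 0, and \<open>y k\<close> is a fixed linear combination of two consecutive such
  differences.\<close>

lemma second_order_recursion_tendsto_0:
  fixes y :: "nat \<Rightarrow> real"
  assumes rec: "\<And>k. y (Suc (Suc k)) = T * y (Suc k) - D * y k"
    and D: "D < 1" and T: "\<bar>T\<bar> < 1 + D"
  shows "y \<longlonglongrightarrow> 0"
proof -
  \<comment> \<open>A Lyapunov function: it drops by \<open>(1 - D) (y (k + 2) - y k)\<^sup>2\<close> in each step.\<close>
  define V where "V k = (1 + D) * ((y (Suc k))\<^sup>2 + (y k)\<^sup>2) - 2 * T * y k * y (Suc k)" for k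
  define e where "e k = y (Suc (Suc k)) - y k" for k
  have step: "V k - V (Suc k) = (1 - D) * (e k)\<^sup>2" for k
    unfolding V_def e_def rec by (simp add: power2_eq_square algebra_simps)
  have "decseq V"
  proof (rule decseq_SucI)
    fix k
    have "0 \<le> (1 - D) * (e k)\<^sup>2" using D by simp
    then show "V (Suc k) \<le> V k" using step[of k] by linarith
  qed
  moreover have "0 \<le> V k" for k
  proof -
    have "2 * T * y k * y (Suc k) \<le> \<bar>T\<bar> * (2 * \<bar>y k * y (Suc k)\<bar>)"
      using abs_ge_self[of "T * (y k * y (Suc k))"] by (simp add: abs_mult mult.assoc)
    also have "\<dots> \<le> \<bar>T\<bar> * ((y (Suc k))\<^sup>2 + (y k)\<^sup>2)"
      using sum_squares_bound[of "\<bar>y k\<bar>" "\<bar>y (Suc k)\<bar>"]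
      by (intro mult_left_mono) (auto simp: abs_mult)
    also have "\<dots> \<le> (1 + D) * ((y (Suc k))\<^sup>2 + (y k)\<^sup>2)"
      using T by (intro mult_right_mono) auto
    finally show ?thesis by (simp add: V_def)
  qed
  ultimately obtain v where v: "V \<longlonglongrightarrow> v"
    using decseq_convergent by blast
  have "(\<lambda>k. V k - V (Suc k)) \<longlonglongrightarrow> v - v"
    by (intro tendsto_diff v LIMSEQ_Suc)
  then have "(\<lambda>k. (V k - V (Suc k)) / (1 - D)) \<longlonglongrightarrow> 0"
    by (auto intro: tendsto_divide_zero)
  then have "(\<lambda>k. (e k)\<^sup>2) \<longlonglongrightarrow> 0"
    using D by (simp add: step)
  then have e0: "e \<longlonglongrightarrow> 0"
    by simp
  \<comment> \<open>By the recursion, \<open>e k\<close> and \<open>e (Suc k)\<close> are linear in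
    \<open>y k\<close> and \<open>y (Suc k)\<close>; eliminating \<open>y (Suc k)\<close> leaves
    this formula. The denominator is positive since \<bar>T\<bar> < 1 + D.\<close>
  have key: "y k = (T\<^sup>2 * e k - (1 + D) * e k - T * e (Suc k)) / ((1 + D)\<^sup>2 - T\<^sup>2)" for k
  proof -
    have "\<bar>T\<bar>\<^sup>2 < (1 + D)\<^sup>2" using T by (intro power_strict_mono) auto
    moreover have "y k * ((1 + D)\<^sup>2 - T\<^sup>2) = T\<^sup>2 * e k - (1 + D) * e k - T * e (Suc k)"
      unfolding e_def rec by (simp add: power2_eq_square algebra_simps)
    ultimately show ?thesis by (simp add: field_simps)
  qed
  have "(\<lambda>k. (T\<^sup>2 * e k - (1 + D) * e k - T * e (Suc k)) / ((1 + D)\<^sup>2 - T\<^sup>2))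
      \<longlonglongrightarrow> (T\<^sup>2 * 0 - (1 + D) * 0 - T * 0) / ((1 + D)\<^sup>2 - T\<^sup>2)"
    using T
    by (intro tendsto_intros e0 LIMSEQ_Suc) (smt (verit) power2_eq_iff)
  then show ?thesis
    unfolding key[symmetric] by simp
qed

lemma decseq_unbounded_at_bot:
  fixes f :: "nat \<Rightarrow> real"
  assumes "decseq f" and unbdd: "\<And>B. \<not> (\<forall>k. B \<le> f k)"
  shows "filterlim f at_bot sequentially"
  unfolding filterlim_at_bot
proof
  fix Z
  obtain k where "f k < Z" using unbdd[of Z] by (auto simp: not_le)
  then show "\<forall>\<^sub>F n in sequentially. f n \<le> Z"
    unfolding eventually_sequentially
    using decseqD[OF \<open>decseq f\<close>] by (meson less_imp_le order_trans)
qed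

section \<open>Equilibria as a recursion in the remaining duration\<close>

text \<open>\<open>slope M\<close> and \<open>discount M\<close> are the coefficients of consumption
  and of expected inflation in the Phillips curve.\<close>

definition slope :: "nk_model \<Rightarrow> real" where
  "slope M = kappa M * (1 + eta M * cbar M)"

definition discount :: "nk_model \<Rightarrow> real" where
  "discount M = mpipi M * beta M"

lemma parameters_pos:
  assumes "admissible M"
  shows "sigma M > 0" "slope M > 0" "psi M > 0" "mu M > 0" "mxx M > 0" "mxx M \<le> 1"
    "mxpi M > 0" "mxpi M \<le> 1" "discount M > 0" "discount M < 1"
proof -
  have "mpipi M * beta M \<le> 1 * beta M"
    using assms unfolding admissible_def by (intro mult_right_mono) auto
  then show "discount M < 1"
    using assms unfolding admissible_def discount_def greaterThanLessThan_iff by linarith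
qed (use assms slope_pos[OF assms] in \<open>auto simp: admissible_def slope_def discount_def\<close>)

text \<open>The index counts the remaining periods in which the low state is possible.\<close>

definition backward_path ::
    "nk_model \<Rightarrow> real \<Rightarrow> real \<Rightarrow> (real \<Rightarrow> real) \<Rightarrow> (nat \<Rightarrow> real) \<Rightarrow> (nat \<Rightarrow> real) \<Rightarrow> bool" where
  "backward_path M p d i c \<pi> \<longleftrightarrow> c 0 = 0 \<and> \<pi> 0 = 0 \<and>
     (\<forall>k. c (Suc k) = mxx M * (p * c k)
                      - sigma M * (i (\<pi> (Suc k)) - mxpi M * (p * \<pi> k) + d) \<and>
          \<pi> (Suc k) = discount M * (p * \<pi> k) + slope M * c (Suc k))"

lemma backward_pathD:
  assumes "backward_path M p d i c \<pi>"
  shows "c 0 = 0" "\<pi> 0 = 0"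
    and "c (Suc k) = mxx M * (p * c k)
           - sigma M * (i (\<pi> (Suc k)) - mxpi M * (p * \<pi> k) + d)"
    and "\<pi> (Suc k) = discount M * (p * \<pi> k) + slope M * c (Suc k)"
  using assms unfolding backward_path_def by blast+

text \<open>Replaces \<open>policy_rate\<close> by its active branch once the path is known to lie
  on one side of the ELB threshold. Agreement at positive indices is enough, because the rule is
  never evaluated at index 0.\<close>

lemma backward_path_cong:
  assumes "\<And>k. i (\<pi> (Suc k)) = j (\<pi> (Suc k))"
  shows "backward_path M p d i c \<pi> \<longleftrightarrow> backward_path M p d j c \<pi>"
  unfolding backward_path_def assms ..

text \<open>Without a constant term in the rule the recursion is homogeneous in the path and the
  shock together, so one path for \<open>d = 1\<close> yields the paths for all shocks.\<close>

lemma backward_path_scale: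
  assumes "backward_path M p d (\<lambda>x. \<alpha> * x) c \<pi>"
  shows "backward_path M p (r * d) (\<lambda>x. \<alpha> * x) (\<lambda>k. r * c k) (\<lambda>k. r * \<pi> k)"
  unfolding backward_path_def
proof (intro conjI allI)
  note path = backward_pathD[OF assms]
  show "r * c 0 = 0" "r * \<pi> 0 = 0" using path(1,2) by simp_all
  show "r * c (Suc k) = mxx M * (p * (r * c k))
      - sigma M * (\<alpha> * (r * \<pi> (Suc k)) - mxpi M * (p * (r * \<pi> k)) + r * d)" for k
    unfolding path(3)[of k] by (simp add: algebra_simps)
  show "r * \<pi> (Suc k) = discount M * (p * (r * \<pi> k)) + slope M * (r * c (Suc k))" for k
    unfolding path(4)[of k] by (simp add: algebra_simps)
qed

text \<open>At date \<open>n\<close> the low state is possible for \<open>l - n\<close> periods,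
  counting the current one, so one path serves every \<open>l\<close>.\<close>

lemma equilibrium_of_backward_path:
  assumes M: "admissible M" and p: "p \<in> {0..1}"
    and path: "backward_path M p d (policy_rate M) c \<pi>"
  shows "equilibrium M p d l (\<lambda>n s. if s = Low then c (l - n) else 0)
    (\<lambda>n s. if s = Low then \<pi> (l - n) else 0)"
    (is "equilibrium M p d l ?c ?\<pi>")
proof -
  note D = backward_pathD[OF path]
  \<comment> \<open>At the last low date the expectation is the absorbed value 0; there
    \<open>l - Suc n = 0\<close>, and the path starts at 0.\<close>
  have low: "expect_next p l n Low ?c = p * c (l - Suc n)"
    "expect_next p l n Low ?\<pi> = p * \<pi> (l - Suc n)" for n
    using p D(1,2) by (auto simp: expect_next_simps)
  have absorbed: "expect_next p l n Absorbed ?c = 0" "expect_next p l n Absorbed ?\<pi> = 0" for n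
    using p by (auto simp: expect_next_simps)
  show ?thesis
    unfolding equilibrium_def
  proof (intro conjI allI impI)
    fix n s assume H: "s = Absorbed \<or> n < l"
    show "?c n s = mxx M * expect_next p l n s ?c - sigma M *
        (policy_rate M (?\<pi> n s) - mxpi M * expect_next p l n s ?\<pi> + shock_value d s)"
    proof (cases s)
      case Absorbed
      then show ?thesis
        using M by (simp only: absorbed) (simp add: policy_rate_def admissible_def)
    next
      case Low
      with H have "l - n = Suc (l - Suc n)" by auto
      then show ?thesis
        using D(3)[of "l - Suc n"] by (simp only: Low low) simp
    qed
    show "?\<pi> n s = mpipi M * beta M * expect_next p l n s ?\<pi>
        + kappa M * (1 + eta M * cbar M) * ?c n s"
    proof (cases s)
      case Absorbed
      then show ?thesis by (simp only: absorbed) simp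
    next
      case Low
      with H have "l - n = Suc (l - Suc n)" by auto
      then show ?thesis
        using D(4)[of "l - Suc n"] by (simp only: Low low discount_def slope_def) simp
    qed
  qed auto
qed

lemma low_eq_backward_path:
  assumes "admissible M" "p \<in> {0..1}" "backward_path M p d (policy_rate M) c \<pi>" "n < l"
  shows "c_low M p d l n = c (l - n)" "pi_low M p d l n = \<pi> (l - n)"
  using c_low_eq[OF assms(1,2) equilibrium_of_backward_path[OF assms(1-3)] assms(4)]
    pi_low_eq[OF assms(1,2) equilibrium_of_backward_path[OF assms(1-3)] assms(4)]
  by simp_all

text \<open>The initial date reads the path at index \<open>l\<close>, so limits in the duration are
  limits along the path; only \<open>l = 0\<close>, which has no low date, has to be skipped. The
  filter \<open>F\<close> covers both convergence and divergence.\<close>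

lemma low_tendsto_backward_path:
  assumes "admissible M" "p \<in> {0..1}" "backward_path M p d (policy_rate M) c \<pi>"
  shows "filterlim (\<lambda>l. c_low M p d l 0) F sequentially \<longleftrightarrow> filterlim c F sequentially"
    and "filterlim (\<lambda>l. pi_low M p d l 0) F sequentially \<longleftrightarrow> filterlim \<pi> F sequentially"
  by (intro filterlim_cong refl eventually_mono[OF eventually_gt_at_top[of 0]],
      simp add: low_eq_backward_path[OF assms])+

subsection \<open>Constant allocations under an affine interest rate rule\<close>

text \<open>\<open>\<alpha>\<close> is the response of the interest rate to inflation: \<open>\<psi>\<close> in normal times, 0 at the ELB.\<close>

definition allocation_det :: "nk_model \<Rightarrow> real \<Rightarrow> real \<Rightarrow> real" where
  "allocation_det M p \<alpha> = (1 - p * mxx M) * (1 - p * discount M)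
     + sigma M * slope M * (\<alpha> - p * mxpi M)"

text \<open>Cramer's rule: \<open>allocation_det\<close> is the determinant of the two linear
  equations in \<open>c\<close> and \<pi>. The constant \<gamma> lets one statement cover the normal
  rule (\<gamma> = 0) and the ELB (\<alpha> = 0, \<gamma> = - \<open>mu M\<close>).\<close>

lemma affine_allocation_iff:
  assumes K: "slope M \<noteq> 0" and det: "allocation_det M p \<alpha> \<noteq> 0"
  shows "is_constant_allocation M p d (\<lambda>x. \<alpha> * x + \<gamma>) c \<pi> \<longleftrightarrow>
    \<pi> = - sigma M * slope M * (d + \<gamma>) / allocation_det M p \<alpha> \<and>
    c = (1 - p * discount M) * \<pi> / slope M"
proof -
  define K where "K = slope M"
  define b where "b = discount M"
  define D where "D = allocation_det M p \<alpha>"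
  have [simp]: "K \<noteq> 0" "D \<noteq> 0" using assms by (simp_all add: K_def D_def)
  have phillips: "\<pi> = b * (p * \<pi>) + K * c \<longleftrightarrow> c = (1 - p * b) * \<pi> / K"
    by (auto simp: field_simps)
  have "c = mxx M * (p * c) - sigma M * (\<alpha> * \<pi> + \<gamma> - mxpi M * (p * \<pi>) + d)
      \<longleftrightarrow> \<pi> = - sigma M * K * (d + \<gamma>) / D" if "c = (1 - p * b) * \<pi> / K"
  proof -
    have Kc: "K * c = (1 - p * b) * \<pi>" using that by simp
    \<comment> \<open>Multiplying by \<open>K\<close> makes consumption enter only through
      \<open>K * c\<close>, which the Phillips curve expresses by inflation.\<close>
    have "c = mxx M * (p * c) - sigma M * (\<alpha> * \<pi> + \<gamma> - mxpi M * (p * \<pi>) + d)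
        \<longleftrightarrow> K * c * (1 - p * mxx M) + sigma M * K * (\<alpha> * \<pi> + \<gamma> - mxpi M * (p * \<pi>) + d) = 0"
    proof -
      have "K * c * (1 - p * mxx M) + sigma M * K * (\<alpha> * \<pi> + \<gamma> - mxpi M * (p * \<pi>) + d)
          = K * (c - (mxx M * (p * c) - sigma M * (\<alpha> * \<pi> + \<gamma> - mxpi M * (p * \<pi>) + d)))"
        by (simp add: algebra_simps)
      then show ?thesis by simp
    qed
    also have "\<dots> \<longleftrightarrow> D * \<pi> = - sigma M * K * (d + \<gamma>)"
      unfolding Kc D_def allocation_det_def K_def[symmetric] b_def[symmetric]
      by (auto simp: algebra_simps)
    also have "\<dots> \<longleftrightarrow> \<pi> = - sigma M * K * (d + \<gamma>) / D"
      by (auto simp: field_simps)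
    finally show ?thesis .
  qed
  then show ?thesis
    unfolding is_constant_allocation_def discount_def[symmetric] slope_def[symmetric]
      K_def[symmetric] b_def[symmetric] D_def[symmetric] phillips
    by blast
qed

lemma affine_allocation_the:
  assumes "slope M \<noteq> 0" "allocation_det M p \<alpha> \<noteq> 0"
    and "is_constant_allocation M p d (\<lambda>x. \<alpha> * x + \<gamma>) c \<pi>"
  shows "(THE (c, \<pi>). is_constant_allocation M p d (\<lambda>x. \<alpha> * x + \<gamma>) c \<pi>) = (c, \<pi>)"
  using assms(3) by (intro the_equality) (auto simp: affine_allocation_iff[OF assms(1,2)])

lemma normal_allocation_eq:
  assumes "slope M \<noteq> 0" "allocation_det M p (psi M) \<noteq> 0"
    and "is_constant_allocation M p d (\<lambda>x. psi M * x) c \<pi>"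
  shows "normal_allocation M p d = (c, \<pi>)"
  using affine_allocation_the[of M p "psi M" d 0] assms by (simp add: normal_allocation_def)

lemma trap_allocation_eq:
  assumes "slope M \<noteq> 0" "allocation_det M p 0 \<noteq> 0"
    and "is_constant_allocation M p d (\<lambda>_. - mu M) c \<pi>"
  shows "trap_allocation M p d = (c, \<pi>)"
  using affine_allocation_the[of M p 0 d "- mu M"] assms by (simp add: trap_allocation_def)

text \<open>The rule responds to inflation of the same period, so each step is a linear equation for
  the new inflation rate. \<open>Y\<close> is its solution, and the assumption says that its
  coefficient \<open>G\<close> is nonzero.\<close>

lemma affine_path_exists:
  assumes "1 + slope M * sigma M * \<alpha> \<noteq> 0"
  shows "\<exists>c \<pi>. backward_path M p d (\<lambda>x. \<alpha> * x + \<gamma>) c \<pi>"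
proof -
  define K where "K = slope M"
  define G where "G = 1 + K * sigma M * \<alpha>"
  have "G \<noteq> 0" using assms by (simp add: G_def K_def)
  define X where "X = (\<lambda>(u, v). mxx M * (p * u) - sigma M * (\<gamma> - mxpi M * (p * v) + d))"
  define Y where "Y z = (discount M * (p * snd z) + K * X z) / G" for z
  define g where "g = rec_nat (0, 0) (\<lambda>_ z. (X z - sigma M * \<alpha> * Y z, Y z))"
  have g: "g 0 = (0, 0)" "g (Suc k) = (X (g k) - sigma M * \<alpha> * Y (g k), Y (g k))" for k
    by (simp_all add: g_def)
  have Y: "Y z = discount M * (p * snd z) + K * (X z - sigma M * \<alpha> * Y z)" for z
  proof -
    have "Y z * G = discount M * (p * snd z) + K * X z"
      using \<open>G \<noteq> 0\<close> by (simp add: Y_def)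
    then show ?thesis by (simp add: G_def algebra_simps)
  qed
  have "backward_path M p d (\<lambda>x. \<alpha> * x + \<gamma>) (fst \<circ> g) (snd \<circ> g)"
    unfolding backward_path_def K_def[symmetric]
  proof (intro conjI allI)
    fix k
    show "(snd \<circ> g) (Suc k) = discount M * (p * (snd \<circ> g) k) + K * (fst \<circ> g) (Suc k)"
      using Y[of "g k"] by (simp add: g)
  qed (auto simp: g X_def split_beta algebra_simps)
  then show ?thesis by blast
qed

subsection \<open>The normal regime\<close>

text \<open>On [0,1] the determinant is smallest at \<open>p = 1\<close>, where its positivity is
  the condition on \<open>psi M\<close> cleared of denominators.\<close>

lemma normal_det_pos:
  assumes M: "admissible M" and p: "p \<in> {0..1}"
    and psi: "psi M > mxpi M + (1 - mxx M) * (discount M - 1) / (slope M * sigma M)"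
  shows "allocation_det M p (psi M) > 0"
proof -
  note pos = parameters_pos[OF M]
  have sK: "sigma M * slope M > 0" using pos by simp
  have "(psi M - mxpi M) * (slope M * sigma M) > (1 - mxx M) * (discount M - 1)"
    using psi sK by (subst pos_divide_less_eq[symmetric]) (auto simp: mult.commute)
  then have "0 < (1 - mxx M) * (1 - discount M) + sigma M * slope M * (psi M - mxpi M)"
    by (simp add: algebra_simps)
  also have "\<dots> \<le> allocation_det M p (psi M)"
  proof -
    have le: "p * mxx M \<le> mxx M" "p * mxpi M \<le> mxpi M" "p * discount M \<le> discount M"
      using p pos by (auto intro!: mult_left_le_one_le)
    then have "(1 - mxx M) * (1 - discount M) \<le> (1 - p * mxx M) * (1 - p * discount M)"
      using pos by (intro mult_mono) linarith+
    moreover have "sigma M * slope M * (psi M - mxpi M)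
        \<le> sigma M * slope M * (psi M - p * mxpi M)"
      using le sK by (intro mult_left_mono) auto
    ultimately show ?thesis
      unfolding allocation_det_def by (rule add_mono)
  qed
  finally show ?thesis .
qed

text \<open>The deviations \<open>y\<close> and \<open>x\<close> from the constant allocation
  satisfy the recursion without its shock term. The Phillips curve expresses \<open>x\<close>
  through \<open>y\<close>; substitution leaves a second-order recursion for \<open>y\<close>, and
  convergence of \<open>x\<close> follows from that of \<open>y\<close>.\<close>

lemma normal_path_tendsto:
  assumes M: "admissible M" and p: "p \<in> {0..1}"
    and det: "allocation_det M p (psi M) > 0"
    and path: "backward_path M p d (\<lambda>x. psi M * x) c \<pi>"
  shows "\<pi> \<longlonglongrightarrow> pi_normal M p d" "c \<longlonglongrightarrow> c_normal M p d"
proof -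
  define K where "K = slope M"
  define b where "b = discount M"
  define G where "G = 1 + K * sigma M * psi M"
  note pos = parameters_pos[OF M, folded K_def]
  have b: "0 < b" "b < 1"
    using parameters_pos[OF M] by (simp_all add: b_def)
  have G: "G > 1" using pos by (simp add: G_def)
  define P where "P = - sigma M * K * (d + 0) / allocation_det M p (psi M)"
  define C where "C = (1 - p * b) * P / K"
  have alloc: "is_constant_allocation M p d (\<lambda>x. psi M * x) C P"
    using affine_allocation_iff[of M p "psi M" d 0 C P] det pos
    by (simp add: C_def P_def K_def b_def)
  then have normal: "pi_normal M p d = P" "c_normal M p d = C"
    using normal_allocation_eq det pos by (auto simp: K_def)
  have CP: "C = mxx M * (p * C) - sigma M * (psi M * P - mxpi M * (p * P) + d)"
    "P = b * (p * P) + K * C"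
    using alloc by (simp_all add: is_constant_allocation_def b_def K_def discount_def slope_def)
  note path = backward_pathD[OF path, folded K_def b_def]
  define y where "y k = \<pi> k - P" for k
  define x where "x k = c k - C" for k
  have x: "x (Suc k) = mxx M * (p * x k) - sigma M * (psi M * y (Suc k) - mxpi M * (p * y k))"
    and Kx: "K * x (Suc k) = y (Suc k) - b * (p * y k)" for k
    using path(3,4)[of k] CP unfolding x_def y_def by algebra+
  have scaled_rec: "G * y (Suc (Suc k))
      = p * (mxx M + b + K * sigma M * mxpi M) * y (Suc k) - p\<^sup>2 * mxx M * b * y k" for k
    using x[of "Suc k"] Kx[of k] Kx[of "Suc k"] unfolding G_def by algebra
  have "y \<longlonglongrightarrow> 0"
  proof (rule second_order_recursion_tendsto_0)
    show "y (Suc (Suc k)) = p * (mxx M + b + K * sigma M * mxpi M) / G * y (Suc k)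
        - p\<^sup>2 * mxx M * b / G * y k" for k
    proof -
      have "y (Suc (Suc k)) = (p * (mxx M + b + K * sigma M * mxpi M) * y (Suc k)
          - p\<^sup>2 * mxx M * b * y k) / G"
        unfolding scaled_rec[symmetric] using G by simp
      then show ?thesis by (simp add: diff_divide_distrib)
    qed
    have "p\<^sup>2 * mxx M * b \<le> 1"
      using p pos b by (intro mult_le_one) (auto simp: power_le_one)
    then show "p\<^sup>2 * mxx M * b / G < 1" using G by simp
    \<comment> \<open>Divided by \<open>G\<close>, this is the characteristic polynomial of the
      recursion at 1. As the coefficient of \<open>y (Suc k)\<close> is nonnegative, positivity here
      is the remaining Jury condition.\<close>
    have "allocation_det M p (psi M)
        = G - p * (mxx M + b + K * sigma M * mxpi M) + p\<^sup>2 * mxx M * b"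
      unfolding allocation_det_def G_def K_def b_def by algebra
    then have "p * (mxx M + b + K * sigma M * mxpi M) < G + p\<^sup>2 * mxx M * b" using det by simp
    moreover have "0 \<le> p * (mxx M + b + K * sigma M * mxpi M)" using p pos b by simp
    ultimately show "\<bar>p * (mxx M + b + K * sigma M * mxpi M) / G\<bar> < 1 + p\<^sup>2 * mxx M * b / G"
      using G divide_strict_right_mono[of "p * (mxx M + b + K * sigma M * mxpi M)"
          "G + p\<^sup>2 * mxx M * b" G]
      by (simp add: add_divide_distrib)
  qed
  then have "(\<lambda>k. (y (Suc k) - b * (p * y k)) / K) \<longlonglongrightarrow> (0 - b * (p * 0)) / K"
    using pos by (intro tendsto_intros LIMSEQ_Suc) auto
  then have "(\<lambda>k. x (Suc k)) \<longlonglongrightarrow> 0"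
    using pos by (simp add: Kx[symmetric])
  then have "x \<longlonglongrightarrow> 0" by (rule LIMSEQ_imp_Suc)
  then show "\<pi> \<longlonglongrightarrow> pi_normal M p d" "c \<longlonglongrightarrow> c_normal M p d"
    using \<open>y \<longlonglongrightarrow> 0\<close> unfolding normal x_def y_def by (simp_all add: LIM_zero_iff)
qed

text \<open>The path for the unit shock converges, hence is bounded by some \<open>B\<close>. Its
  multiple by \<open>d\<close> stays above \<open>pibar M\<close> as soon as
  \<open>d * B < mu M / psi M\<close>, which gives the threshold.\<close>

lemma normal_regime:
  assumes M: "admissible M" and p: "p \<in> {0..1}"
    and det: "allocation_det M p (psi M) > 0"
  shows "\<exists>dN>0. \<forall>d\<in>{0..<dN}. (\<forall>l\<ge>1. remains_normal M p d l) \<and>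
    (\<lambda>l. pi_low M p d l 0) \<longlonglongrightarrow> pi_normal M p d \<and>
    (\<lambda>l. c_low M p d l 0) \<longlonglongrightarrow> c_normal M p d"
proof -
  note pos = parameters_pos[OF M]
  have "1 + slope M * sigma M * psi M > 0"
    using pos by (intro add_pos_pos mult_pos_pos) auto
  then obtain c \<pi> where path: "backward_path M p 1 (\<lambda>x. psi M * x) c \<pi>"
    using affine_path_exists[of M "psi M" p 1 0] by auto
  have "Bseq \<pi>"
    using normal_path_tendsto(1)[OF M p det path] by (rule convergent_imp_Bseq[OF convergentI])
  then obtain B where B: "B > 0" "\<And>k. \<bar>\<pi> k\<bar> \<le> B"
    unfolding Bseq_def by auto
  have "(\<forall>l\<ge>1. remains_normal M p d l) \<and>
    (\<lambda>l. pi_low M p d l 0) \<longlonglongrightarrow> pi_normal M p d \<and>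
    (\<lambda>l. c_low M p d l 0) \<longlonglongrightarrow> c_normal M p d"
    if d: "0 \<le> d" "d < mu M / (psi M * B)" for d
  proof -
    have scaled: "backward_path M p d (\<lambda>x. psi M * x) (\<lambda>k. d * c k) (\<lambda>k. d * \<pi> k)"
      using backward_path_scale[OF path, of d] by simp
    have above: "pibar M < d * \<pi> k" for k
    proof -
      have "- (d * \<pi> k) \<le> d * B"
        using d(1) B(2)[of k] mult_left_mono[of "- \<pi> k" B d] by simp
      also have "\<dots> < mu M / psi M" using d(2) B(1) pos by (simp add: field_simps)
      finally show ?thesis by (simp add: pibar_def)
    qed
    have "policy_rate M (d * \<pi> k) = psi M * (d * \<pi> k)" for k
      using above[of k] pos by (simp add: policy_rate_def pibar_def max_def field_simps)
    then have full: "backward_path M p d (policy_rate M) (\<lambda>k. d * c k) (\<lambda>k. d * \<pi> k)"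
      using scaled backward_path_cong[of "policy_rate M" "\<lambda>k. d * \<pi> k" "\<lambda>x. psi M * x"] by blast
    show ?thesis
      unfolding low_tendsto_backward_path[OF M p full] remains_normal_def
      using low_eq_backward_path(2)[OF M p full] above normal_path_tendsto[OF M p det scaled]
      by simp
  qed
  moreover have "mu M / (psi M * B) > 0" using pos B(1) by simp
  ultimately show ?thesis by (intro exI[of _ "mu M / (psi M * B)"]) auto
qed

subsection \<open>The ELB regime\<close>

text \<open>\<open>dbar M 0\<close> exceeds \<open>mu M\<close> by
  \<open>mu M / (sigma M * psi M * slope M)\<close>, exactly what puts inflation at
  \<open>pibar M\<close> after one step at the ELB.\<close>

lemma dbar_0_le_imp:
  assumes M: "admissible M" and d: "dbar M 0 \<le> d"
  shows "mu M < d" "slope M * (sigma M * (mu M - d)) \<le> pibar M"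
proof -
  define K where "K = slope M"
  note pos = parameters_pos[OF M, folded K_def]
  have "dbar M 0 = mu M * (1 + sigma M * K * psi M) / (sigma M * psi M * K)"
    by (simp add: dbar_def K_def slope_def mult.assoc)
  also have "\<dots> = mu M + mu M / (sigma M * psi M * K)"
    using pos by (simp add: field_simps)
  finally have le: "mu M + mu M / (sigma M * psi M * K) \<le> d" using d by simp
  moreover have "0 < mu M / (sigma M * psi M * K)" using pos by simp
  ultimately show "mu M < d" by linarith
  have "mu M / (sigma M * psi M * K) \<le> d - mu M" using le by simp
  then have "mu M / psi M \<le> K * (sigma M * (d - mu M))"
    using pos by (simp add: field_simps)
  then show "slope M * (sigma M * (mu M - d)) \<le> pibar M"
    unfolding K_def[symmetric] pibar_def by (simp add: algebra_simps)
qed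

context
  fixes M p d c \<pi>
  assumes M: "admissible M" and p: "p \<in> {0..1}" and d: "dbar M 0 \<le> d"
    and path: "backward_path M p d (\<lambda>_. - mu M) c \<pi>"
begin

private lemmas pos = parameters_pos[OF M]

private lemma step:
  "c 0 = 0" "\<pi> 0 = 0"
  "c (Suc k) = mxx M * p * c k + sigma M * mxpi M * p * \<pi> k + sigma M * (mu M - d)"
  "\<pi> (Suc k) = discount M * p * \<pi> k + slope M * c (Suc k)"
  using backward_pathD[OF path] by (simp_all add: algebra_simps)

text \<open>All coefficients are nonnegative. This order preservation serves to compare the path
  with its own shift and with its fixed point.\<close>

private lemma step_mono:
  assumes "u \<le> u'" "v \<le> v'"
  shows "mxx M * p * u + sigma M * mxpi M * p * v + sigma M * (mu M - d)
      \<le> mxx M * p * u' + sigma M * mxpi M * p * v' + sigma M * (mu M - d)"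
    and "discount M * p * v + slope M * u \<le> discount M * p * v' + slope M * u'"
  using assms pos p by (auto intro!: add_mono mult_left_mono mult_nonneg_nonneg)

lemma elb_path_first: "c 1 < 0" "\<pi> 1 < 0" "\<pi> 1 \<le> pibar M"
  using step(3)[of 0] step(4)[of 0] step(1,2) dbar_0_le_imp[OF M d] pos
  by (simp_all add: mult_pos_neg)

lemma elb_path_decseq: "decseq c" "decseq \<pi>"
proof -
  have "c (Suc k) \<le> c k \<and> \<pi> (Suc k) \<le> \<pi> k" for k
  proof (induction k)
    case 0
    show ?case using elb_path_first step(1,2) by simp
  next
    case (Suc k)
    then have "c (Suc (Suc k)) \<le> c (Suc k)"
      using step_mono(1) by (subst (1 2) step(3)) blast
    \<comment> \<open>Inflation depends on consumption of the same step, so consumption is compared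
      first.\<close>
    moreover from this have "\<pi> (Suc (Suc k)) \<le> \<pi> (Suc k)"
      using step_mono(2) Suc by (subst (1 2) step(4)) blast
    ultimately show ?case ..
  qed
  then show "decseq c" "decseq \<pi>" by (auto intro: decseq_SucI)
qed

text \<open>The path is built with the rate pinned at \<open>- mu M\<close>. Being decreasing, it
  stays at or below \<open>pibar M\<close> from index 1 on, where the maximum in the rule does
  select \<open>- mu M\<close>.\<close>

lemma elb_path_policy: "backward_path M p d (policy_rate M) c \<pi>"
  and elb_path_le: "k > 0 \<Longrightarrow> \<pi> k \<le> pibar M"
proof -
  show le: "\<pi> k \<le> pibar M" if "k > 0" for k
    using elb_path_first(3) decseqD[OF elb_path_decseq(2), of 1 k] that by simp
  have "policy_rate M (\<pi> (Suc k)) = - mu M" for k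
    using le[of "Suc k"] pos by (simp add: policy_rate_def pibar_def max_def field_simps)
  then show "backward_path M p d (policy_rate M) c \<pi>"
    using path backward_path_cong[of "policy_rate M" \<pi> "\<lambda>_. - mu M"] by blast
qed

lemma elb_path_limit_allocation:
  assumes "c \<longlonglongrightarrow> C" "\<pi> \<longlonglongrightarrow> P"
  shows "is_constant_allocation M p d (\<lambda>_. - mu M) C P"
proof -
  have "(\<lambda>k. c (Suc k)) \<longlonglongrightarrow> mxx M * p * C + sigma M * mxpi M * p * P + sigma M * (mu M - d)"
    unfolding step(3) by (intro tendsto_intros assms)
  then have "C = mxx M * p * C + sigma M * mxpi M * p * P + sigma M * (mu M - d)"
    using LIMSEQ_unique LIMSEQ_Suc[OF assms(1)] by blast
  moreover have "(\<lambda>k. \<pi> (Suc k)) \<longlonglongrightarrow> discount M * p * P + slope M * C"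
    unfolding step(4) by (intro tendsto_intros LIMSEQ_Suc assms)
  then have "P = discount M * p * P + slope M * C"
    using LIMSEQ_unique LIMSEQ_Suc[OF assms(2)] by blast
  ultimately show ?thesis
    by (simp add: is_constant_allocation_def discount_def slope_def algebra_simps)
qed

text \<open>Past inflation is nonpositive, so \<open>slope M * c (Suc k)\<close> is at least
  inflation in the same step. In contrapositive form this carries divergence over from consumption
  to inflation.\<close>

lemma elb_path_bdd_c_if:
  assumes "\<And>k. B \<le> \<pi> k"
  shows "B / slope M \<le> c k"
proof -
  have nonpos: "\<pi> k \<le> 0" for k using decseqD[OF elb_path_decseq(2), of 0 k] step(2) by simp
  have "discount M * p * \<pi> k \<le> 0"
    using pos p nonpos by (intro mult_nonneg_nonpos) auto
  then have "B \<le> slope M * c (Suc k)" using assms[of "Suc k"] step(4)[of k] by linarith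
  also have "\<dots> \<le> slope M * c k"
    using pos decseqD[OF elb_path_decseq(1), of k "Suc k"] by simp
  finally show ?thesis using pos by (simp add: field_simps)
qed

lemma elb_path_bdd_pi_if:
  assumes "\<And>k. B \<le> c k"
  shows "slope M * B / (1 - discount M) \<le> \<pi> k"
proof -
  define b where "b = discount M"
  have b: "0 < b" "b < 1" using pos by (simp_all add: b_def)
  have B: "B \<le> 0" using assms[of 0] step(1) by simp
  \<comment> \<open>The fixed point of the Phillips recursion with consumption held at
    \<open>B\<close> and \<open>p\<close> replaced by 1. As \<open>Q\<close> is nonpositive, the
    smaller factor \<open>b * p\<close> can only raise the right-hand side.\<close>
  define Q where "Q = slope M * B / (1 - b)"
  have Q: "Q \<le> 0" "b * Q + slope M * B = Q"
    using b B pos by (auto simp: Q_def field_simps mult_le_0_iff)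
  have "Q \<le> \<pi> k"
  proof (induction k)
    case (Suc k)
    have "b * p \<le> b" using b p by (simp add: mult_left_le)
    then have "Q \<le> b * p * Q + slope M * B"
      using Q mult_right_mono_neg[of "b * p" b Q] by simp
    also have "\<dots> \<le> b * p * \<pi> k + slope M * c (Suc k)"
      using Suc assms pos b p by (intro add_mono mult_left_mono) auto
    finally show ?case using step(4)[of k] by (simp add: b_def)
  qed (use Q step in simp)
  then show ?thesis by (simp add: Q_def b_def)
qed

text \<open>A positive determinant makes the constant allocation nonpositive, hence below the start
  of the path, and monotonicity keeps it below. The decreasing path then converges, and its limit is
  the only constant allocation.\<close>

lemma elb_path_tendsto:
  assumes det: "allocation_det M p 0 > 0"
  shows "c \<longlonglongrightarrow> c_trap M p d" "\<pi> \<longlonglongrightarrow> pi_trap M p d"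
proof -
  define P where "P = - sigma M * slope M * (d + - mu M) / allocation_det M p 0"
  define C where "C = (1 - p * discount M) * P / slope M"
  have alloc: "is_constant_allocation M p d (\<lambda>_. - mu M) C P"
    using affine_allocation_iff[of M p 0 d "- mu M" C P] det pos by (simp add: C_def P_def)
  have CP: "C = mxx M * p * C + sigma M * mxpi M * p * P + sigma M * (mu M - d)"
    "P = discount M * p * P + slope M * C"
    using alloc by (simp_all add: is_constant_allocation_def discount_def slope_def algebra_simps)
  have P0: "P \<le> 0"
    using det pos dbar_0_le_imp(1)[OF M d] unfolding P_def
    by (intro divide_nonpos_pos) (auto simp: mult_le_0_iff)
  have "p * discount M \<le> 1" using p pos by (intro mult_le_one) auto
  then have C0: "C \<le> 0"
    using P0 pos unfolding C_def by (intro divide_nonpos_pos mult_nonneg_nonpos) auto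
  have bound: "C \<le> c k \<and> P \<le> \<pi> k" for k
  proof (induction k)
    case 0
    show ?case using P0 C0 step by simp
  next
    case (Suc k)
    then have "C \<le> c (Suc k)"
      using CP(1) step(3)[of k] step_mono(1)[of C "c k" P "\<pi> k"] by linarith
    moreover from this have "P \<le> \<pi> (Suc k)"
      using CP(2) step(4)[of k] step_mono(2)[of C "c (Suc k)" P "\<pi> k"] Suc by linarith
    ultimately show ?case ..
  qed
  obtain C' where C': "c \<longlonglongrightarrow> C'"
    using decseq_convergent[OF elb_path_decseq(1), of C] bound by blast
  obtain P' where P': "\<pi> \<longlonglongrightarrow> P'"
    using decseq_convergent[OF elb_path_decseq(2), of P] bound by blast
  have "trap_allocation M p d = (C', P')"
    using trap_allocation_eq[OF _ _ elb_path_limit_allocation[OF C' P']] pos det by simp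
  then show "c \<longlonglongrightarrow> c_trap M p d" "\<pi> \<longlonglongrightarrow> pi_trap M p d"
    using C' P' by simp_all
qed

text \<open>Bounded consumption would bound inflation too, and the limit \<open>P < 0\<close> of
  inflation would satisfy \<open>allocation_det M p 0 * P < 0\<close>. A nonpositive determinant,
  zero included, excludes this.\<close>

lemma elb_path_diverges:
  assumes det: "allocation_det M p 0 \<le> 0"
  shows "filterlim c at_bot sequentially" "filterlim \<pi> at_bot sequentially"
proof -
  have c: "\<not> (\<forall>k. B \<le> c k)" for B
  proof
    assume B: "\<forall>k. B \<le> c k"
    obtain C where C: "c \<longlonglongrightarrow> C"
      using decseq_convergent[OF elb_path_decseq(1)] B by blast
    have "slope M * B / (1 - discount M) \<le> \<pi> k" for k
      using B by (intro elb_path_bdd_pi_if) simp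
    then obtain P where P: "\<pi> \<longlonglongrightarrow> P"
      using decseq_convergent[OF elb_path_decseq(2)] by metis
    have eq: "C = mxx M * (p * C) - sigma M * (- mu M - mxpi M * (p * P) + d)"
      "P = discount M * (p * P) + slope M * C"
      using elb_path_limit_allocation[OF C P]
      by (simp_all add: is_constant_allocation_def discount_def slope_def)
    have "P \<le> \<pi> 1" by (rule decseq_ge[OF elb_path_decseq(2) P])
    then have "P < 0" using elb_path_first by simp
    moreover have "allocation_det M p 0 * P = sigma M * slope M * (mu M - d)"
      using eq unfolding allocation_det_def by algebra
    moreover have "sigma M * slope M * (mu M - d) < 0"
      using pos dbar_0_le_imp(1)[OF M d] by (simp add: mult_pos_neg)
    ultimately show False using det mult_nonpos_nonpos[of "allocation_det M p 0" P] by simp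
  qed
  then have "\<not> (\<forall>k. B \<le> \<pi> k)" for B using elb_path_bdd_c_if[of B] by blast
  with c show "filterlim c at_bot sequentially" "filterlim \<pi> at_bot sequentially"
    by (auto intro!: decseq_unbounded_at_bot elb_path_decseq)
qed

end

lemma elb_path_exists: "\<exists>c \<pi>. backward_path M p d (\<lambda>_. - mu M) c \<pi>"
  using affine_path_exists[of M 0 p d "- mu M"] by simp

lemma elb_regime:
  assumes M: "admissible M" and p: "p \<in> {0..1}" and d: "dbar M 0 \<le> d"
  shows "remains_elb M p d l"
    and "allocation_det M p 0 > 0 \<Longrightarrow> (\<lambda>l. c_low M p d l 0) \<longlonglongrightarrow> c_trap M p d"
    and "allocation_det M p 0 > 0 \<Longrightarrow> (\<lambda>l. pi_low M p d l 0) \<longlonglongrightarrow> pi_trap M p d"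
    and "allocation_det M p 0 \<le> 0 \<Longrightarrow> filterlim (\<lambda>l. c_low M p d l 0) at_bot sequentially"
    and "allocation_det M p 0 \<le> 0 \<Longrightarrow> filterlim (\<lambda>l. pi_low M p d l 0) at_bot sequentially"
proof -
  obtain c \<pi> where path: "backward_path M p d (\<lambda>_. - mu M) c \<pi>"
    using elb_path_exists by blast
  note full = elb_path_policy[OF M p d path]
  note low = low_tendsto_backward_path[OF M p full]
  show "remains_elb M p d l"
    unfolding remains_elb_def
    using low_eq_backward_path(2)[OF M p full] elb_path_le[OF M p d path] by simp
  show "allocation_det M p 0 > 0 \<Longrightarrow> (\<lambda>l. c_low M p d l 0) \<longlonglongrightarrow> c_trap M p d"
    and "allocation_det M p 0 > 0 \<Longrightarrow> (\<lambda>l. pi_low M p d l 0) \<longlonglongrightarrow> pi_trap M p d"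
    and "allocation_det M p 0 \<le> 0 \<Longrightarrow> filterlim (\<lambda>l. c_low M p d l 0) at_bot sequentially"
    and "allocation_det M p 0 \<le> 0 \<Longrightarrow> filterlim (\<lambda>l. pi_low M p d l 0) at_bot sequentially"
    unfolding low
    using elb_path_tendsto[OF M p d path] elb_path_diverges[OF M p d path] by blast+
qed

section \<open>The threshold in the persistence of the shock\<close>

text \<open>The product has nonnegative, nonincreasing factors; strictness comes from the linear
  term, as \<open>mxpi M > 0\<close>.\<close>

lemma trap_det_strict_antimono:
  assumes M: "admissible M" and "0 \<le> p" "p < p'" "p' \<le> 1"
  shows "allocation_det M p' 0 < allocation_det M p 0"
proof -
  note pos = parameters_pos[OF M]
  define b where "b = discount M"
  have b: "0 < b" "b < 1"
    using parameters_pos[OF M] by (simp_all add: b_def)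
  have "(1 - p' * mxx M) * (1 - p' * b) \<le> (1 - p * mxx M) * (1 - p * b)"
    using assms pos b mult_le_one[of p' b] mult_le_one[of p "mxx M"]
    by (intro mult_mono diff_left_mono mult_right_mono) auto
  moreover have "sigma M * slope M * (0 - p' * mxpi M) < sigma M * slope M * (0 - p * mxpi M)"
    using assms pos by (intro mult_strict_left_mono) auto
  ultimately show ?thesis
    unfolding allocation_det_def b_def by linarith
qed

lemma trap_threshold:
  assumes M: "admissible M"
  shows "\<exists>pbar. 0 < pbar \<and> pbar \<le> 1 \<and> (allocation_det M 1 0 < 0 \<longrightarrow> pbar < 1) \<and>
    (\<forall>p\<in>{0<..<1}. p < pbar \<longleftrightarrow> allocation_det M p 0 > 0)"
proof (cases "allocation_det M 1 0 < 0")
  case True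
  have det0: "allocation_det M 0 0 = 1" by (simp add: allocation_det_def)
  have "continuous_on {0..1} (\<lambda>p. allocation_det M p 0)"
    unfolding allocation_det_def by (intro continuous_intros)
  then obtain r where r: "0 \<le> r" "r \<le> 1" "allocation_det M r 0 = 0"
    using IVT2'[of "\<lambda>p. allocation_det M p 0" 1 0 0] True det0 by auto
  then have "r \<noteq> 0" "r \<noteq> 1" using True det0 by auto
  moreover have "p < r \<longleftrightarrow> allocation_det M p 0 > 0" if "p \<in> {0<..<1}" for p
    using trap_det_strict_antimono[OF M, of p r] trap_det_strict_antimono[OF M, of r p] r that
    by (cases p r rule: linorder_cases) auto
  ultimately show ?thesis using r by (intro exI[of _ r]) auto
next
  case False
  have "allocation_det M p 0 > 0" if "p \<in> {0<..<1}" for p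
    using trap_det_strict_antimono[OF M, of p 1] that False by auto
  with False show ?thesis
    by (intro exI[of _ 1]) auto
qed

theorem proposition4:
  fixes M :: nk_model and dmax :: real
  assumes "admissible M"
    and "psi M > mxpi M + (1 - mxx M) * (beta M * mpipi M - 1)
                          / (kappa M * (1 + eta M * cbar M) * sigma M)"
  shows "\<exists>(dN :: real \<Rightarrow> real) (pbar :: real).
    (\<forall>p\<in>{0<..<1}. 0 < dN p) \<and>
    0 < pbar \<and> pbar \<le> 1 \<and>
    ((1 - mxx M) * (1 - beta M * mpipi M)
       < sigma M * kappa M * (1 + eta M * cbar M) * mxpi M \<longrightarrow> pbar < 1) \<and>
    (\<forall>p\<in>{0<..<1}.
      (\<forall>d\<in>{0..<dN p}.
         (\<forall>l\<ge>1. remains_normal M p d l) \<and>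
         (\<lambda>l. pi_low M p d l 0) \<longlonglongrightarrow> pi_normal M p d \<and>
         (\<lambda>l. c_low M p d l 0) \<longlonglongrightarrow> c_normal M p d) \<and>
      (\<forall>d\<in>{dbar M 0..dmax}. \<forall>l\<ge>1. remains_elb M p d l) \<and>
      (\<forall>d\<in>{dbar M 0..dmax}.
         (p < pbar \<longrightarrow>
            (\<lambda>l. c_low M p d l 0) \<longlonglongrightarrow> c_trap M p d \<and>
            (\<lambda>l. pi_low M p d l 0) \<longlonglongrightarrow> pi_trap M p d) \<and>
         (pbar \<le> p \<longrightarrow>
            filterlim (\<lambda>l. c_low M p d l 0) at_bot sequentially \<and>
            filterlim (\<lambda>l. pi_low M p d l 0) at_bot sequentially)))"
proof -
  obtain pbar where pbar: "0 < pbar" "pbar \<le> 1" "allocation_det M 1 0 < 0 \<Longrightarrow> pbar < 1"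
    "\<And>p. p \<in> {0<..<1} \<Longrightarrow> p < pbar \<longleftrightarrow> allocation_det M p 0 > 0"
    using trap_threshold[OF assms(1)] by blast
  have "\<exists>dN>0. \<forall>d\<in>{0..<dN}. (\<forall>l\<ge>1. remains_normal M p d l) \<and>
      (\<lambda>l. pi_low M p d l 0) \<longlonglongrightarrow> pi_normal M p d \<and>
      (\<lambda>l. c_low M p d l 0) \<longlonglongrightarrow> c_normal M p d" if "p \<in> {0<..<1}" for p
    using that by (intro normal_regime normal_det_pos assms(1))
      (use assms(2) in \<open>auto simp: discount_def slope_def mult.commute\<close>)
  then obtain dN where dN: "\<And>p. p \<in> {0<..<1} \<Longrightarrow> 0 < dN p"
    "\<And>p d. p \<in> {0<..<1} \<Longrightarrow> d \<in> {0..<dN p} \<Longrightarrow> (\<forall>l\<ge>1. remains_normal M p d l) \<and>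
      (\<lambda>l. pi_low M p d l 0) \<longlonglongrightarrow> pi_normal M p d \<and>
      (\<lambda>l. c_low M p d l 0) \<longlonglongrightarrow> c_normal M p d"
    by metis
  \<comment> \<open>The condition is \<open>allocation_det M 1 0 < 0\<close> written out in the
    parameters.\<close>
  have "pbar < 1" if "(1 - mxx M) * (1 - beta M * mpipi M)
      < sigma M * kappa M * (1 + eta M * cbar M) * mxpi M"
    using that by (intro pbar(3)) (simp add: allocation_det_def discount_def slope_def mult_ac)
  moreover have "(p < pbar \<longrightarrow> (\<lambda>l. c_low M p d l 0) \<longlonglongrightarrow> c_trap M p d \<and>
        (\<lambda>l. pi_low M p d l 0) \<longlonglongrightarrow> pi_trap M p d) \<and>
      (pbar \<le> p \<longrightarrow> filterlim (\<lambda>l. c_low M p d l 0) at_bot sequentially \<and>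
        filterlim (\<lambda>l. pi_low M p d l 0) at_bot sequentially)"
    "remains_elb M p d l"
    if "p \<in> {0<..<1}" "d \<in> {dbar M 0..dmax}" for p d l
    using elb_regime[OF assms(1), of p d] pbar(4)[of p] that by (auto simp: not_less[symmetric])
  ultimately show ?thesis
    using dN pbar(1,2) by (intro exI[of _ dN] exI[of _ pbar] conjI ballI) blast+
qed

end
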